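(* Let $\gamma:[0,1]\to\mathbb{R}^d$ be a non-degenerate piecewise linear path with derivative $f$ such that $\lVert f(t)\rVert_2=1$ for all $t\in(0,1)$ at which it is defined. Assume $\gamma$ is differentiable at $\theta\in(0,1)$. For $n\ge1$ put $p=p(n)=\lfloor\theta(n+2)\rfloor$ (which lies in $\{1,\dots,n+1\}$ for all large $n$; only such $n$ are considered). Let $(\epsilon_n)_n$ be a sequence of nonnegative reals with $\epsilon_n\to0$ and $\lVert I_{p,n}(f(\theta))-\bar S_{n+1}\rVert_\pi\le\epsilon_n$ for all $n$ considered, and set $$A_n:=\left\{x\in\mathbb{R}^d:\ \lVert x\rVert_2=1,\ \lVert I_{p,n}(x)-\bar S_{n+1}\rVert_\pi\le\epsilon_n\right\}.$$ Then there exists a strictly increasing sequence $(n_k)_{k\ge1}$ of natural numbers such that for all choices of $x_k,y_k\in A_{n_k}$ ($k\ge1$), $$\lVert x_k-y_k\rVert_2\to0\quad\text{as }k\to\infty .$$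
   Context: Normalised signature: $\bar S_n:=n!\int_{0<u_1<\cdots<u_n<1}f(u_1)\otimes\cdots\otimes f(u_n)\,du_1\cdots du_n\in(\mathbb{R}^d)^{\otimes n}$. Insertion map: for $p\in\{1,\dots,n+1\}$, $I_{p,n}:\mathbb{R}^d\to(\mathbb{R}^d)^{\otimes(n+1)}$ is $$I_{p,n}(x):=n!\int_{0<u_1<\cdots<u_n<1}f(u_1)\otimes\cdots\otimes f(u_{p-1})\otimes x\otimes f(u_p)\otimes\cdots\otimes f(u_n)\,du_1\cdots du_n .$$ $\lVert\cdot\rVert_2$ is the Euclidean norm, and $\lVert\cdot\rVert_\pi$ is the projective tensor norm on $(\mathbb{R}^d)^{\otimes k}$ induced by it: $\lVert x\rVert_\pi=\inf\sum_i\lVert v_{i,1}\rVert_2\cdots\lVert v_{i,k}\rVert_2$ over finite representations $x=\sum_i v_{i,1}\otimes\cdots\otimes v_{i,k}$. Non-degenerate piecewise linear path: a (continuous) concatenation of finitely many line segments of positive length with successive vertices $x_0,\dots,x_M$ such that for each $0<i<M$ the angle in $[0,\pi]$ between $x_{i-1}-x_i$ and $x_{i+1}-x_i$ lies in $(0,\pi)$. A sequence $(\epsilon_n)$ as in the claim always exists, since for such $\gamma$ and $\theta$ one has $\lVert I_{p,n}(f(\theta))-\bar S_{n+1}\rVert_\pi\to0$ as $n\to\infty$. *)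

theory Defs
  imports "HOL-Analysis.Analysis"
begin

text \<open>The angle in \<open>[0, \<pi>]\<close> between two nonzero vectors.\<close>

definition vec_angle :: "real ^ 'd \<Rightarrow> real ^ 'd \<Rightarrow> real" where
  "vec_angle v w = arccos ((v \<bullet> w) / (norm v * norm w))"

text \<open>The path runs linearly along the segment from \<open>x i\<close> to \<open>x (i + 1)\<close> during the time interval
  \<open>[s i, s (i + 1)]\<close>. Only the values of \<open>\<gamma>\<close> on \<open>[0, 1]\<close> are constrained.\<close>

definition nondegenerate_pl_path :: "(real \<Rightarrow> real ^ 'd) \<Rightarrow> bool" where
  "nondegenerate_pl_path \<gamma> \<longleftrightarrow>
    (\<exists>(M::nat) (s :: nat \<Rightarrow> real) (x :: nat \<Rightarrow> real ^ 'd).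
      s 0 = 0 \<and> s M = 1 \<and>
      (\<forall>i<M. s i < s (Suc i) \<and> x i \<noteq> x (Suc i) \<and>
        (\<forall>t\<in>{s i..s (Suc i)}.
          \<gamma> t = linepath (x i) (x (Suc i)) ((t - s i) / (s (Suc i) - s i)))) \<and>
      (\<forall>i. 0 < i \<and> i < M \<longrightarrow>
        vec_angle (x (i - 1) - x i) (x (i + 1) - x i) \<in> {0<..<pi}))"

text \<open>Since the order of the tensors varies, an element of the \<open>k\<close>-fold tensor power of
  \<open>\<real>\<^sup>d\<close> is represented by its array of coordinates with respect to the basis
  \<open>e\<^bsub>i\<^sub>1\<^esub> \<otimes> \<dots> \<otimes> e\<^bsub>i\<^sub>k\<^esub>\<close>, as a function on multi-indices which
  vanishes on lists whose length is not \<open>k\<close>.\<close>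

type_synonym 'd tensor = "'d list \<Rightarrow> real"

definition elem_tensor :: "(real ^ 'd) list \<Rightarrow> 'd tensor" where
  "elem_tensor vs =
    (\<lambda>is. if length is = length vs then \<Prod>j<length vs. (vs ! j) $ (is ! j) else 0)"

definition proj_norm :: "nat \<Rightarrow> 'd::finite tensor \<Rightarrow> real" where
  "proj_norm k T =
    Inf {\<Sum>vs\<leftarrow>R. prod_list (map norm vs) | R :: (real ^ 'd) list list.
      (\<forall>vs\<in>set R. length vs = k) \<and> T = (\<lambda>is. \<Sum>vs\<leftarrow>R. elem_tensor vs is)}"

definition open_simplex :: "nat \<Rightarrow> (nat \<Rightarrow> real) set" where
  "open_simplex n =
    {u \<in> {1..n} \<rightarrow>\<^sub>E UNIV. (\<forall>i\<in>{1..n}. 0 < u i \<and> u i < 1) \<and> (\<forall>i\<in>{1..<n}. u i < u (i + 1))}"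

text \<open>Tensor-valued integrals are taken coordinatewise.\<close>

definition simplex_integral :: "nat \<Rightarrow> ((nat \<Rightarrow> real) \<Rightarrow> 'd tensor) \<Rightarrow> 'd tensor" where
  "simplex_integral n F =
    (\<lambda>is. LINT u:open_simplex n|PiM {1..n} (\<lambda>_. lborel). F u is)"

definition normalised_signature :: "(real \<Rightarrow> real ^ 'd) \<Rightarrow> nat \<Rightarrow> 'd tensor" where
  "normalised_signature f n =
    (\<lambda>is. fact n * simplex_integral n (\<lambda>u. elem_tensor (map (\<lambda>i. f (u i)) [1..<n + 1])) is)"

text \<open>The vector \<open>x\<close> is inserted so as to become the \<open>p\<close>-th tensor factor (counting from 1);
  meaningful for \<open>1 \<le> p \<le> n + 1\<close>.\<close>

definition insertion_map ::
    "(real \<Rightarrow> real ^ 'd) \<Rightarrow> nat \<Rightarrow> nat \<Rightarrow> real ^ 'd \<Rightarrow> 'd tensor" where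
  "insertion_map f p n x =
    (\<lambda>is. fact n * simplex_integral n
      (\<lambda>u. elem_tensor (map (\<lambda>i. f (u i)) [1..<p] @ x # map (\<lambda>i. f (u i)) [p..<n + 1])) is)"

definition insertion_pos :: "real \<Rightarrow> nat \<Rightarrow> nat" where
  "insertion_pos \<theta> n = nat \<lfloor>\<theta> * (real n + 2)\<rfloor>"

text \<open>The indices \<open>n\<close> for which the insertion map at position \<open>insertion_pos \<theta> n\<close> is defined.\<close>

definition admissible :: "real \<Rightarrow> nat \<Rightarrow> bool" where
  "admissible \<theta> n \<longleftrightarrow> 1 \<le> n \<and> insertion_pos \<theta> n \<in> {1..n + 1}"

definition insertion_defect :: "(real \<Rightarrow> real ^ 'd::finite) \<Rightarrow> real \<Rightarrow> nat \<Rightarrow> real ^ 'd \<Rightarrow> real" where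
  "insertion_defect f \<theta> n x =
    proj_norm (n + 1) (insertion_map f (insertion_pos \<theta> n) n x - normalised_signature f (n + 1))"

definition insertion_candidates ::
    "(real \<Rightarrow> real ^ 'd::finite) \<Rightarrow> real \<Rightarrow> (nat \<Rightarrow> real) \<Rightarrow> nat \<Rightarrow> (real ^ 'd) set" where
  "insertion_candidates f \<theta> \<epsilon> n = {x. norm x = 1 \<and> insertion_defect f \<theta> n x \<le> \<epsilon> n}"

end

theory Submission
  imports Defs
begin

text \<open>The tensor \<open>I\<^bsub>p,n\<^esub>(x)\<close> is the normalised signature \<open>S\<^sub>n\<close> with \<open>x\<close> placed in slot \<open>p\<close>, so
  contracting slot \<open>p\<close> with a vector \<open>z\<close> turns it into \<open>(z \<bullet> x) S\<^sub>n\<close>. Let \<open>\<phi>\<close> be a functional on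
  \<open>n\<close>-tensors of norm at most 1 for the projective norm. Contracting with \<open>z = x - y\<close> and then
  applying \<open>\<phi>\<close> shows that \<open>\<parallel>x - y\<parallel> \<phi>(S\<^sub>n)\<close> is at most the sum of the defects of \<open>x\<close> and \<open>y\<close>
  (\<open>insertion_defect_separates\<close>), so at most \<open>2 \<epsilon>\<^sub>n\<close> for two candidates. It therefore suffices to
  find such functionals \<open>\<phi>\<^sub>n\<close> for which \<open>\<phi>\<^sub>n(S\<^sub>n)\<close> stays away from 0 along a subsequence; the even
  \<open>n\<close> will do.

  To this end every vector \<open>v\<close> acts on \<open>\<real>\<^sup>d \<times> \<real>\<close> as the infinitesimal Lorentz boost
  \<open>(a, b) \<mapsto> (b v, a \<bullet> v)\<close>, whose operator norm is \<open>\<parallel>v\<parallel>\<close>. Applying the boosts of the factors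
  \<open>v\<^sub>1, \<dots>, v\<^sub>n\<close> in turn to \<open>(0, 1)\<close> and taking the last coordinate gives \<open>\<phi>\<^sub>n\<close>. Its value on the
  signature is \<open>n!\<close> times the last coordinate of \<open>D\<^sub>n(1)\<close>, where \<open>D\<^sub>0 = (0, 1)\<close> and
  \<open>D\<^bsub>n+1\<^esub>' = boost D\<^sub>n f\<close> (\<open>iterated_integral_increment\<close>).

  On a segment with unit velocity \<open>v\<close> the boost is diagonalisable with eigenvalues \<open>1\<close>, \<open>-1\<close>
  and \<open>0\<close>. Consequently \<open>n! D\<^sub>n(t)\<close> is a finite combination of powers \<open>\<mu>\<^sup>n\<close> with vector
  coefficients, and during the segment every base \<open>\<mu>\<close> splits into three, moving with speeds \<open>1\<close>,
  \<open>-1\<close> and \<open>0\<close> (\<open>flow_solves\<close>). The bases of largest modulus are the ones that have always moved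
  outwards, \<open>t\<close> and \<open>-t\<close>; their coefficients are \<open>c (v, 1)\<close> and \<open>c (-v, 1)\<close>, where \<open>c\<close> starts at
  \<open>1/2\<close> and is multiplied at a corner from \<open>v'\<close> to \<open>v\<close> by \<open>(1 + v' \<bullet> v)/2\<close>. This factor is positive
  because the path never doubles back (\<open>dominated_by_flow\<close>). At \<open>t = 1\<close> all other bases have
  modulus below 1, and for even \<open>n\<close> the last coordinates of the two leading terms add up, so
  \<open>\<phi>\<^sub>n(S\<^sub>n)\<close> tends to \<open>2 c > 0\<close>.\<close>

section \<open>Boosts and developments of lists of vectors\<close>

text \<open>The infinitesimal Lorentz boost in direction \<open>v\<close>, that is, the symmetric matrix with off-diagonal
  blocks \<open>v\<close> and \<open>v\<^sup>T\<close>, applied to \<open>z\<close>.\<close>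

definition boost :: "(real ^ 'd) \<times> real \<Rightarrow> real ^ 'd \<Rightarrow> (real ^ 'd) \<times> real" where
  "boost z v = (snd z *\<^sub>R v, fst z \<bullet> v)"

lemma norm_boost_le: "norm (boost z v) \<le> norm z * norm v"
proof -
  have "(fst z \<bullet> v)\<^sup>2 \<le> (norm (fst z) * norm v)\<^sup>2"
    using Cauchy_Schwarz_ineq2[of "fst z" v] by (metis abs_ge_zero power2_abs power_mono)
  then have "(snd z)\<^sup>2 * (norm v)\<^sup>2 + (fst z \<bullet> v)\<^sup>2 \<le> ((norm (fst z))\<^sup>2 + (snd z)\<^sup>2) * (norm v)\<^sup>2"
    by (simp add: power_mult_distrib algebra_simps)
  then have "sqrt ((snd z)\<^sup>2 * (norm v)\<^sup>2 + (fst z \<bullet> v)\<^sup>2)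
      \<le> sqrt (((norm (fst z))\<^sup>2 + (snd z)\<^sup>2) * (norm v)\<^sup>2)"
    by (rule real_sqrt_le_mono)
  then show ?thesis
    by (simp add: boost_def norm_prod_def power_mult_distrib real_sqrt_mult)
qed

lemma bounded_bilinear_boost: "bounded_bilinear (boost :: (real ^ 'd) \<times> real \<Rightarrow> real ^ 'd \<Rightarrow> _)"
proof
  show "\<exists>K. \<forall>a b. norm (boost a (b :: real ^ 'd)) \<le> norm a * norm b * K"
    by (rule exI[of _ 1]) (simp add: norm_boost_le)
qed (auto simp: boost_def algebra_simps inner_simps)

lemmas linear_boost = bounded_linear.linear[OF bounded_bilinear.bounded_linear_left[OF bounded_bilinear_boost]]

abbreviation develop :: "(real ^ 'd) \<times> real \<Rightarrow> (real ^ 'd) list \<Rightarrow> (real ^ 'd) \<times> real" where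
  "develop \<equiv> foldl boost"

lemma norm_develop_le: "norm (develop z vs) \<le> norm z * prod_list (map norm vs)"
proof (induction vs arbitrary: z)
  case (Cons v vs)
  have "norm (develop (boost z v) vs) \<le> norm (boost z v) * prod_list (map norm vs)"
    by (rule Cons)
  also have "\<dots> \<le> (norm z * norm v) * prod_list (map norm vs)"
    by (intro mult_right_mono norm_boost_le prod_list_nonneg) auto
  finally show ?case by (simp add: mult.assoc)
qed simp

lemma linear_develop: "linear (\<lambda>z. develop z vs)"
proof (induction vs)
  case (Cons v vs)
  show ?case using linear_compose[OF linear_boost[of v] Cons] by (simp add: o_def)
qed (simp add: linear_id[unfolded id_def])

section \<open>Coordinates of elementary tensors\<close>

lemma elem_tensor_Nil: "elem_tensor [] is = (if is = [] then 1 else 0)"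
  by (simp add: elem_tensor_def)

lemma elem_tensor_Cons: "elem_tensor (v # vs) (i # is) = v $ i * elem_tensor vs is"
  by (simp add: elem_tensor_def prod.lessThan_Suc_shift del: prod.lessThan_Suc)

lemma elem_tensor_append:
  "length is = length vs \<Longrightarrow> elem_tensor (vs @ ws) (is @ js) = elem_tensor vs is * elem_tensor ws js"
  by (induction "is" vs rule: list_induct2) (simp_all add: elem_tensor_Nil elem_tensor_Cons)

lemma elem_tensor_insert:
  assumes "length is = length vs"
  shows "elem_tensor (vs @ x # ws) (is @ i # js) = x $ i * elem_tensor (vs @ ws) (is @ js)"
  using assms by (simp add: elem_tensor_append elem_tensor_Cons)

lemma elem_tensor_axis:
  "length is = length js \<Longrightarrow> elem_tensor (map (\<lambda>i. axis i 1) is) js = (if is = js then 1 else 0)"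
  by (induction "is" js rule: list_induct2) (auto simp: elem_tensor_Nil elem_tensor_Cons axis_def)

lemma finite_multi_indices: "finite {is :: 'd::finite list. length is = n}"
  using finite_lists_length_eq[of "UNIV :: 'd set" n] by simp

lemma sum_multi_indices_Suc:
  fixes F :: "'d::finite list \<Rightarrow> 'a::comm_monoid_add"
  shows "(\<Sum>is | length is = Suc n. F is) = (\<Sum>i\<in>UNIV. \<Sum>is | length is = n. F (i # is))"
proof -
  have "{is :: 'd list. length is = Suc n} = (\<lambda>(i, is). i # is) ` (UNIV \<times> {is. length is = n})"
    by (auto simp: length_Suc_conv image_iff)
  moreover have "inj_on (\<lambda>(i, is). i # is) (UNIV \<times> {is :: 'd list. length is = n})"
    by (auto simp: inj_on_def)
  ultimately have "(\<Sum>is | length is = Suc n. F is)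
      = (\<Sum>(i, is)\<in>UNIV \<times> {is. length is = n}. F (i # is))"
    by (simp add: sum.reindex case_prod_unfold)
  then show ?thesis by (simp add: sum.cartesian_product)
qed

text \<open>Developing a list is multilinear in its entries, so it is determined by the lists of basis vectors;
  this is what makes it a functional on tensors.\<close>

lemma develop_expansion:
  "develop z vs =
    (\<Sum>is | length is = length vs. elem_tensor vs is *\<^sub>R develop z (map (\<lambda>i. axis i 1) is))"
proof (induction vs arbitrary: z)
  case Nil
  then show ?case by (simp add: elem_tensor_Nil)
next
  case (Cons v vs)
  interpret B: bounded_bilinear "boost :: (real ^ 'a) \<times> real \<Rightarrow> real ^ 'a \<Rightarrow> _"
    by (rule bounded_bilinear_boost)
  have "boost z v = (\<Sum>i\<in>UNIV. v $ i *\<^sub>R boost z (axis i 1))"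
    using B.sum_right[of z "\<lambda>i. v $ i *\<^sub>R axis i 1" UNIV] basis_expansion[of v]
    by (simp add: scalar_mult_eq_scaleR B.scaleR_right)
  then have "develop z (v # vs) = develop (\<Sum>i\<in>UNIV. v $ i *\<^sub>R boost z (axis i 1)) vs"
    by simp
  also have "\<dots> = (\<Sum>i\<in>UNIV. v $ i *\<^sub>R develop (boost z (axis i 1)) vs)"
    using linear_sum[OF linear_develop[of vs], of "\<lambda>i. v $ i *\<^sub>R boost z (axis i 1)" UNIV]
    by (simp add: linear_scale[OF linear_develop[of vs]])
  also have "\<dots> = (\<Sum>i\<in>UNIV. \<Sum>is | length is = length vs.
      elem_tensor (v # vs) (i # is) *\<^sub>R develop z (map (\<lambda>i. axis i 1) (i # is)))"
    by (subst Cons) (simp add: elem_tensor_Cons scaleR_sum_right)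
  also have "\<dots> = (\<Sum>is | length is = length (v # vs).
      elem_tensor (v # vs) is *\<^sub>R develop z (map (\<lambda>i. axis i 1) is))"
    by (simp add: sum_multi_indices_Suc del: map_eq_Cons_conv)
  finally show ?case .
qed

text \<open>The linear functional which sends \<open>v\<^sub>1 \<otimes> \<dots> \<otimes> v\<^sub>n\<close> to the last coordinate of the development of
  \<open>v\<^sub>1, \<dots>, v\<^sub>n\<close>. For even \<open>n\<close> that is \<open>(v\<^sub>1 \<bullet> v\<^sub>2) (v\<^sub>3 \<bullet> v\<^sub>4) \<dots> (v\<^bsub>n-1\<^esub> \<bullet> v\<^sub>n)\<close>, and for odd \<open>n\<close> it
  is 0.\<close>

definition dev_functional :: "nat \<Rightarrow> 'd::finite tensor \<Rightarrow> real" where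
  "dev_functional n T =
    (\<Sum>is | length is = n. T is * snd (develop (0, 1) (map (\<lambda>i. axis i 1) is)))"

lemma dev_functional_elem_tensor:
  "dev_functional (length vs) (elem_tensor vs) = snd (develop (0, 1) vs)"
  by (subst develop_expansion) (simp add: dev_functional_def snd_sum)

section \<open>Functionals bounded by the projective norm\<close>

text \<open>Contraction of the tensor factor at index \<open>q\<close>, counting from 0, with \<open>z\<close>.\<close>

definition contract :: "nat \<Rightarrow> real ^ 'd \<Rightarrow> 'd::finite tensor \<Rightarrow> 'd tensor" where
  "contract q z T = (\<lambda>is. \<Sum>i\<in>UNIV. z $ i * T (take q is @ i # drop q is))"

lemma contract_elem_tensor:
  assumes "length vs = Suc n" "q \<le> n" "length is = n"
  shows "contract q z (elem_tensor vs) is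
    = (z \<bullet> vs ! q) * elem_tensor (take q vs @ drop (Suc q) vs) is"
proof -
  have "vs = take q vs @ vs ! q # drop (Suc q) vs"
    using assms by (simp add: id_take_nth_drop)
  then have "elem_tensor vs (take q is @ i # drop q is)
      = vs ! q $ i * elem_tensor (take q vs @ drop (Suc q) vs) (take q is @ drop q is)" for i
    using assms elem_tensor_insert[of "take q is" "take q vs" "vs ! q" "drop (Suc q) vs" i "drop q is"]
    by simp
  then show ?thesis
    by (simp add: contract_def inner_vec_def sum_distrib_right mult.assoc)
qed

text \<open>A boost increases norms by at most the factor \<open>\<parallel>v\<parallel>\<close>, and the contracted factor costs
  \<open>\<parallel>z\<parallel>\<close> times its norm by Cauchy--Schwarz.\<close>

lemma dev_functional_contract_elem_le:
  assumes "length vs = Suc n" "q \<le> n"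
  shows "\<bar>dev_functional n (contract q z (elem_tensor vs))\<bar> \<le> norm z * prod_list (map norm vs)"
proof -
  let ?ws = "take q vs @ drop (Suc q) vs"
  have len: "length ?ws = n" using assms by simp
  have vs: "vs = take q vs @ vs ! q # drop (Suc q) vs"
    using assms by (simp add: id_take_nth_drop)
  have "dev_functional n (contract q z (elem_tensor vs))
      = (z \<bullet> vs ! q) * dev_functional n (elem_tensor ?ws)"
    unfolding dev_functional_def sum_distrib_left
    by (intro sum.cong) (simp_all add: contract_elem_tensor[OF assms] mult.assoc)
  also have "\<dots> = (z \<bullet> vs ! q) * snd (develop (0, 1) ?ws)"
    using dev_functional_elem_tensor[of ?ws] unfolding len by simp
  finally have eq: "dev_functional n (contract q z (elem_tensor vs))
      = (z \<bullet> vs ! q) * snd (develop (0, 1) ?ws)" .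
  have "\<bar>snd (develop (0, 1) ?ws)\<bar> \<le> norm (develop (0, 1) ?ws)"
    by (metis norm_snd_le prod.collapse real_norm_def)
  also have "\<dots> \<le> prod_list (map norm ?ws)"
    using norm_develop_le[of "(0, 1)" ?ws] by (simp add: norm_prod_def)
  finally have "\<bar>(z \<bullet> vs ! q) * snd (develop (0, 1) ?ws)\<bar>
      \<le> (norm z * norm (vs ! q)) * prod_list (map norm ?ws)"
    unfolding abs_mult by (intro mult_mono Cauchy_Schwarz_ineq2) auto
  also have "\<dots> = norm z * prod_list (map norm (take q vs @ vs ! q # drop (Suc q) vs))"
    by (simp add: algebra_simps)
  finally show ?thesis unfolding eq vs[symmetric] .
qed

lemma contract_sum_list: 
  "contract q z (\<lambda>is. \<Sum>x\<leftarrow>R. F x is) js = (\<Sum>x\<leftarrow>R. contract q z (F x) js)"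
  by (induction R) (simp_all add: contract_def sum.distrib algebra_simps)

lemma dev_functional_sum_list:
  "dev_functional n (\<lambda>is. \<Sum>x\<leftarrow>R. F x is) = (\<Sum>x\<leftarrow>R. dev_functional n (F x))"
  by (induction R) (simp_all add: dev_functional_def sum.distrib algebra_simps)

lemma contract_diff: "contract q z (S - T) = contract q z S - contract q z T"
  by (rule ext) (simp add: contract_def sum_subtractf algebra_simps)

lemma dev_functional_diff: "dev_functional n (S - T) = dev_functional n S - dev_functional n T"
  by (simp add: dev_functional_def sum_subtractf algebra_simps)

text \<open>The projective norm is an infimum over representations; since the infimum of the empty set of reals
  is unspecified, bounds on it require that a representation exists. Here it is the expansion in the
  basis tensors, with the coefficient absorbed in the first factor.\<close>

lemma tensor_representation:
  fixes T :: "'d::finite tensor"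
  assumes "\<And>is. length is \<noteq> Suc n \<Longrightarrow> T is = 0"
  shows "\<exists>R. (\<forall>vs\<in>set R. length vs = Suc n) \<and> T = (\<lambda>is. \<Sum>vs\<leftarrow>R. elem_tensor vs is)"
proof -
  obtain L :: "'d list list" where L: "set L = {is. length is = Suc n}" "distinct L"
    using finite_distinct_list[OF finite_multi_indices] by blast
  define g :: "'d list \<Rightarrow> (real ^ 'd) list"
    where "g is = (T is *\<^sub>R axis (hd is) 1) # map (\<lambda>i. axis i 1) (tl is)" for "is"
  have g: "elem_tensor (g is) js = (if is = js then T js else 0)" if len: "length is = Suc n" for "is" js
  proof (cases "length js = Suc n")
    case True
    obtain i is' where "is = i # is'" "length is' = n"
      using len by (auto simp: length_Suc_conv)
    moreover obtain j js' where "js = j # js'" "length js' = n"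
      using True by (auto simp: length_Suc_conv)
    ultimately show ?thesis
      by (simp add: g_def elem_tensor_Cons elem_tensor_axis) (auto simp: axis_def)
  next
    case False
    then show ?thesis using that assms by (auto simp: g_def elem_tensor_def)
  qed
  have "T js = (\<Sum>vs\<leftarrow>map g L. elem_tensor vs js)" for js
  proof -
    have "(\<Sum>vs\<leftarrow>map g L. elem_tensor vs js) = (\<Sum>is\<leftarrow>L. elem_tensor (g is) js)"
      by (simp add: o_def)
    also have "\<dots> = (\<Sum>is | length is = Suc n. elem_tensor (g is) js)"
      using L by (simp add: sum_list_distinct_conv_sum_set)
    also have "\<dots> = (\<Sum>is | length is = Suc n. if is = js then T js else 0)"
      by (rule sum.cong) (auto simp: g)
    also have "\<dots> = T js"
      using assms by (simp add: finite_multi_indices)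
    finally show ?thesis by simp
  qed
  moreover have "\<forall>vs\<in>set (map g L). length vs = Suc n"
    using L by (auto simp: g_def)
  ultimately show ?thesis by blast
qed

lemma dev_functional_contract_le:
  fixes T :: "'d::finite tensor"
  assumes supp: "\<And>is. length is \<noteq> Suc n \<Longrightarrow> T is = 0" and "q \<le> n"
  shows "\<bar>dev_functional n (contract q z T)\<bar> \<le> norm z * proj_norm (Suc n) T"
proof (cases "z = 0")
  case True
  then show ?thesis by (simp add: contract_def dev_functional_def)
next
  case False
  let ?\<phi> = "\<lambda>T. dev_functional n (contract q z T)"
  have "\<bar>?\<phi> T\<bar> / norm z \<le> proj_norm (Suc n) T"
    unfolding proj_norm_def
  proof (rule cInf_greatest)
    show "{\<Sum>vs\<leftarrow>R. prod_list (map norm vs) | R :: (real ^ 'd) list list.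
      (\<forall>vs\<in>set R. length vs = Suc n) \<and> T = (\<lambda>is. \<Sum>vs\<leftarrow>R. elem_tensor vs is)} \<noteq> {}"
    proof -
      obtain R where "(\<forall>vs\<in>set R. length vs = Suc n) \<and> T = (\<lambda>is. \<Sum>vs\<leftarrow>R. elem_tensor vs is)"
        using tensor_representation[OF supp] ..
      then have "(\<Sum>vs\<leftarrow>R. prod_list (map norm vs)) \<in> {\<Sum>vs\<leftarrow>R. prod_list (map norm vs) | R.
          (\<forall>vs\<in>set R. length vs = Suc n) \<and> T = (\<lambda>is. \<Sum>vs\<leftarrow>R. elem_tensor vs is)}"
        unfolding mem_Collect_eq by (intro exI conjI refl) auto
      then show ?thesis by (metis (no_types, lifting) empty_iff)
    qed
  next
    fix s assume "s \<in> {\<Sum>vs\<leftarrow>R. prod_list (map norm vs) | R :: (real ^ 'd) list list.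
      (\<forall>vs\<in>set R. length vs = Suc n) \<and> T = (\<lambda>is. \<Sum>vs\<leftarrow>R. elem_tensor vs is)}"
    then obtain R :: "(real ^ 'd) list list" where R: "\<forall>vs\<in>set R. length vs = Suc n"
        "T = (\<lambda>is. \<Sum>vs\<leftarrow>R. elem_tensor vs is)" "s = (\<Sum>vs\<leftarrow>R. prod_list (map norm vs))"
      unfolding mem_Collect_eq by (elim exE conjE) (rule that)
    have "contract q z T = (\<lambda>js. \<Sum>vs\<leftarrow>R. contract q z (elem_tensor vs) js)"
      unfolding R(2) by (rule ext) (rule contract_sum_list)
    then have "\<bar>?\<phi> T\<bar> = \<bar>\<Sum>vs\<leftarrow>R. ?\<phi> (elem_tensor vs)\<bar>"
      by (simp add: dev_functional_sum_list)
    also have "\<dots> \<le> (\<Sum>vs\<leftarrow>R. \<bar>?\<phi> (elem_tensor vs)\<bar>)"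
      using sum_list_abs[of "map (\<lambda>vs. ?\<phi> (elem_tensor vs)) R"] by (simp add: o_def)
    also have "\<dots> \<le> (\<Sum>vs\<leftarrow>R. norm z * prod_list (map norm vs))"
      using R(1) \<open>q \<le> n\<close> by (intro sum_list_mono dev_functional_contract_elem_le) auto
    also have "\<dots> = norm z * s"
      by (simp add: R(3) sum_list_const_mult)
    finally show "\<bar>?\<phi> T\<bar> / norm z \<le> s"
      using False by (simp add: field_simps)
  qed
  then show ?thesis using False by (simp add: field_simps)
qed

section \<open>Iterated integrals over simplices\<close>

text \<open>Fubini's theorem with the new coordinate as the outer variable, which is the order needed to peel
  off the largest time of a simplex.\<close>

lemma (in product_sigma_finite) product_integral_insert_rev:
  fixes F :: "_ \<Rightarrow> _::{banach, second_countable_topology}"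
  assumes I: "finite I" "i \<notin> I" and F: "integrable (Pi\<^sub>M (insert i I) M) F"
  shows "integrable (M i) (\<lambda>y. \<integral>x. F (x(i := y)) \<partial>Pi\<^sub>M I M)"
    and "integral\<^sup>L (Pi\<^sub>M (insert i I) M) F = (\<integral>y. (\<integral>x. F (x(i := y)) \<partial>Pi\<^sub>M I M) \<partial>M i)"
proof -
  interpret I: finite_product_sigma_finite M I by standard fact
  interpret P: pair_sigma_finite "Pi\<^sub>M I M" "M i"
    by (intro pair_sigma_finite.intro I.sigma_finite_measure_axioms sigma_finite_measures)
  have [measurable]: "F \<in> borel_measurable (Pi\<^sub>M (insert i I) M)"
    using F by auto
  have meas: "(\<lambda>(x, y). F (x(i := y))) \<in> borel_measurable (Pi\<^sub>M I M \<Otimes>\<^sub>M M i)"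
    using measurable_compose[OF measurable_add_dim[of i I M], of F borel]
    by (simp add: case_prod_unfold)
  have "(\<integral>\<^sup>+p. norm (case p of (x, y) \<Rightarrow> F (x(i := y))) \<partial>(Pi\<^sub>M I M \<Otimes>\<^sub>M M i))
      = (\<integral>\<^sup>+x. \<integral>\<^sup>+y. norm (F (x(i := y))) \<partial>M i \<partial>Pi\<^sub>M I M)"
    using sigma_finite_measure.nn_integral_fst[OF sigma_finite_measures,
      OF measurable_compose[OF measurable_compose[OF meas borel_measurable_norm] measurable_ennreal]]
    by simp
  also have "\<dots> = (\<integral>\<^sup>+u. norm (F u) \<partial>Pi\<^sub>M (insert i I) M)"
    using I by (subst product_nn_integral_insert) auto
  also have "\<dots> < \<infinity>"
    using F by (simp add: integrable_iff_bounded)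
  finally have int: "integrable (Pi\<^sub>M I M \<Otimes>\<^sub>M M i) (\<lambda>(x, y). F (x(i := y)))"
    using meas by (intro integrableI_bounded) auto
  show "integrable (M i) (\<lambda>y. \<integral>x. F (x(i := y)) \<partial>Pi\<^sub>M I M)"
    using P.integrable_snd[OF int] .
  show "integral\<^sup>L (Pi\<^sub>M (insert i I) M) F = (\<integral>y. (\<integral>x. F (x(i := y)) \<partial>Pi\<^sub>M I M) \<partial>M i)"
    unfolding product_integral_insert[OF I F] using P.Fubini_integral[OF int] by simp
qed

abbreviation cube_measure :: "nat \<Rightarrow> (nat \<Rightarrow> real) measure" where
  "cube_measure n \<equiv> Pi\<^sub>M {1..n} (\<lambda>_. lborel)"

text \<open>The simplex with variable endpoint, needed for a recursion over its dimension.\<close>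

definition simplex_upto :: "nat \<Rightarrow> real \<Rightarrow> (nat \<Rightarrow> real) set" where
  "simplex_upto n t =
    {u \<in> {1..n} \<rightarrow>\<^sub>E UNIV. (\<forall>i\<in>{1..n}. 0 < u i \<and> u i < t) \<and> (\<forall>i\<in>{1..<n}. u i < u (i + 1))}"

definition word :: "(real \<Rightarrow> real ^ 'd) \<Rightarrow> nat \<Rightarrow> (nat \<Rightarrow> real) \<Rightarrow> (real ^ 'd) list" where
  "word f n u = map (\<lambda>i. f (u i)) [1..<n + 1]"

lemma length_word [simp]: "length (word f n u) = n"
  by (simp add: word_def)

lemma open_simplex_eq: "open_simplex n = simplex_upto n 1"
  by (simp add: open_simplex_def simplex_upto_def)

lemma sets_simplex_upto [measurable]: "simplex_upto n t \<in> sets (cube_measure n)"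
proof -
  have "simplex_upto n t = {u \<in> space (cube_measure n).
      (\<forall>i\<in>{1..n}. 0 < u i \<and> u i < t) \<and> (\<forall>i\<in>{1..<n}. u i < u (i + 1))}"
    by (simp add: simplex_upto_def space_PiM)
  also have "\<dots> \<in> sets (cube_measure n)"
    by measurable
  finally show ?thesis .
qed

lemma integrable_elem_tensor_word:
  fixes f :: "real \<Rightarrow> real ^ 'd::finite"
  assumes f: "integrable lborel f" and len: "length is = n"
  shows "set_integrable (cube_measure n) (simplex_upto n t) (\<lambda>u. elem_tensor (word f n u) is)"
proof -
  interpret product_sigma_finite "\<lambda>_. lborel :: real measure"
    by standard
  have "elem_tensor (word f n u) is = (\<Prod>i\<in>{1..n}. f (u i) $ (is ! (i - 1)))" for u
  proof -
    have "elem_tensor (word f n u) is = (\<Prod>j<n. f (u (Suc j)) $ (is ! j))"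
      using len by (simp add: elem_tensor_def word_def del: upt_Suc)
    also have "\<dots> = (\<Prod>i\<in>{1..n}. f (u i) $ (is ! (i - 1)))"
      by (rule prod.reindex_bij_witness[of _ "\<lambda>i. i - 1" Suc]) auto
    finally show ?thesis .
  qed
  moreover have "integrable (cube_measure n) (\<lambda>u. \<Prod>i\<in>{1..n}. f (u i) $ (is ! (i - 1)))"
    by (rule product_integrable_prod[where f = "\<lambda>i y. f y $ (is ! (i - 1))"])
      (auto intro!: integrable_bounded_linear[OF bounded_linear_vec_nth] f)
  ultimately show ?thesis
    unfolding set_integrable_def
    by (intro integrable_mult_indicator) (simp_all add: sets_simplex_upto del: One_nat_def)
qed

lemma integrable_develop_word:
  fixes f :: "real \<Rightarrow> real ^ 'd::finite"
  assumes f: "integrable lborel f"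
  shows "set_integrable (cube_measure n) (simplex_upto n t) (\<lambda>u. develop z (word f n u))"
proof -
  have "integrable (cube_measure n) (\<lambda>u. indicator (simplex_upto n t) u *\<^sub>R
      elem_tensor (word f n u) is *\<^sub>R develop z (map (\<lambda>i. axis i 1) is))"
    if "length is = n" for "is"
    using integrable_scaleR_left[OF integrable_elem_tensor_word[OF f that, unfolded set_integrable_def]]
    by simp
  then have "integrable (cube_measure n) (\<lambda>u. \<Sum>is | length is = n. indicator (simplex_upto n t) u *\<^sub>R
      elem_tensor (word f n u) is *\<^sub>R develop z (map (\<lambda>i. axis i 1) is))"
    by (intro Bochner_Integration.integrable_sum) simp
  then show ?thesis
    unfolding set_integrable_def by (subst develop_expansion) (simp add: scaleR_sum_right del: One_nat_def)
qed

definition iterated_integral :: "(real \<Rightarrow> real ^ 'd::finite) \<Rightarrow> nat \<Rightarrow> real \<Rightarrow> (real ^ 'd) \<times> real" where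
  "iterated_integral f n t =
    (LINT u:simplex_upto n t|cube_measure n. develop (0, 1) (word f n u))"

lemma iterated_integral_0: "iterated_integral f 0 t = (0, 1)"
proof -
  interpret product_sigma_finite "\<lambda>_. lborel :: real measure"
    by standard
  have "iterated_integral f 0 t = (LINT u|cube_measure 0. indicator (simplex_upto 0 t) u *\<^sub>R (0, 1))"
    by (simp add: iterated_integral_def set_lebesgue_integral_def word_def)
  also have "\<dots> = (LINT u|cube_measure 0. (0, 1))"
    by (intro Bochner_Integration.integral_cong) (auto simp: simplex_upto_def space_PiM)
  also have "\<dots> = (0, 1)"
    by (simp add: PiM_empty measure_count_space)
  finally show ?thesis .
qed

lemma simplex_upto_Suc:
  assumes "x \<in> {1..n} \<rightarrow>\<^sub>E UNIV"
  shows "x(Suc n := y) \<in> simplex_upto (Suc n) t \<longleftrightarrow> y \<in> {0<..<t} \<and> x \<in> simplex_upto n y"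
proof -
  (* Comparing with y only at the top coordinate is enough, because the coordinates increase. *)
  have inc: "0 < x i \<and> x i < y" if "\<forall>i\<in>{1..n}. 0 < x i"
    "\<forall>i\<in>{1..<n}. x i < x (Suc i)" "n \<ge> 1 \<longrightarrow> x n < y" "i \<in> {1..n}" for i
  proof -
    have "i \<le> n" using that by simp
    then have "x i \<le> x n"
      using that(2,4)
    proof (induction rule: inc_induct)
      case (step m)
      then have "x m < x (Suc m)" "x (Suc m) \<le> x n" by auto
      then show ?case by simp
    qed simp
    then show ?thesis using that by auto
  qed
  have ext: "x(Suc n := y) \<in> {1..Suc n} \<rightarrow>\<^sub>E UNIV"
    using assms by (auto simp: PiE_def extensional_def)
  show ?thesis (is "?L \<longleftrightarrow> ?R")
  proof
    assume L: ?L
    have range: "0 < (x(Suc n := y)) i \<and> (x(Suc n := y)) i < t" if "i \<in> {1..Suc n}" for i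
      using L that unfolding simplex_upto_def by blast
    have mono: "(x(Suc n := y)) i < (x(Suc n := y)) (i + 1)" if "i \<in> {1..<Suc n}" for i
      using L that unfolding simplex_upto_def by blast
    have 1: "0 < y" "y < t" using range[of "Suc n"] by auto
    have 2: "0 < x i" if "i \<in> {1..n}" for i
      using range[of i] that by auto
    have 3: "x i < x (Suc i)" if "i \<in> {1..<n}" for i
      using mono[of i] that by auto
    have 4: "x n < y" if "n \<ge> 1"
      using mono[of n] that by auto
    show ?R
    proof -
      have "0 < x i \<and> x i < y" if "i \<in> {1..n}" for i
        by (rule inc) (use 2 3 4 that in blast)+
      then show ?thesis
        using 1 3 assms unfolding simplex_upto_def by auto
    qed
  next
    assume R: ?R
    then have "0 < x i \<and> x i < t" if "i \<in> {1..n}" for i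
      using that by (force simp: simplex_upto_def)
    then show ?L
      using R ext unfolding simplex_upto_def by (auto simp: less_Suc_eq)
  qed
qed

lemma word_Suc: "word f (Suc n) (x(Suc n := y)) = word f n x @ [f y]"
  by (simp add: word_def)

text \<open>Integrating over the largest time \<open>y\<close> last leaves the iterated integral up to \<open>y\<close>, and the letter
  at time \<open>y\<close> is the last one to be developed.\<close>

lemma iterated_integral_Suc:
  fixes f :: "real \<Rightarrow> real ^ 'd::finite"
  assumes f: "integrable lborel f"
  shows "set_integrable lborel {0<..<t} (\<lambda>y. boost (iterated_integral f n y) (f y))"
    and "iterated_integral f (Suc n) t = (LINT y:{0<..<t}|lborel. boost (iterated_integral f n y) (f y))"
proof -
  interpret product_sigma_finite "\<lambda>_. lborel :: real measure"
    by standard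
  interpret B: bounded_bilinear "boost :: (real ^ 'd) \<times> real \<Rightarrow> real ^ 'd \<Rightarrow> _"
    by (rule bounded_bilinear_boost)
  define G where "G u = indicator (simplex_upto (Suc n) t) u *\<^sub>R develop (0, 1) (word f (Suc n) u)" for u
  have ins: "insert (Suc n) {1..n} = {1..Suc n}" by auto
  have G: "integrable (Pi\<^sub>M (insert (Suc n) {1..n}) (\<lambda>_. lborel)) G"
    unfolding ins G_def using integrable_develop_word[OF f] by (simp add: set_integrable_def)
  have inner: "(LINT x|cube_measure n. G (x(Suc n := y)))
      = indicator {0<..<t} y *\<^sub>R boost (iterated_integral f n y) (f y)" for y
  proof -
    have "(LINT x|cube_measure n. G (x(Suc n := y)))
        = (LINT x|cube_measure n. indicator {0<..<t} y *\<^sub>R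
            boost (indicator (simplex_upto n y) x *\<^sub>R develop (0, 1) (word f n x)) (f y))"
    proof (rule Bochner_Integration.integral_cong[OF refl])
      fix x assume "x \<in> space (cube_measure n)"
      then have "x \<in> {1..n} \<rightarrow>\<^sub>E UNIV" by (simp add: space_PiM)
      from simplex_upto_Suc[OF this, of y t]
      show "G (x(Suc n := y)) = indicator {0<..<t} y *\<^sub>R
            boost (indicator (simplex_upto n y) x *\<^sub>R develop (0, 1) (word f n x)) (f y)"
        by (auto simp: G_def word_Suc indicator_def B.zero_left)
    qed
    also have "\<dots> = indicator {0<..<t} y *\<^sub>R boost (iterated_integral f n y) (f y)"
      using integral_bounded_linear[OF B.bounded_linear_left[of "f y"]
          integrable_develop_word[OF f, of n y "(0, 1)", unfolded set_integrable_def]]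
      by (simp add: iterated_integral_def set_lebesgue_integral_def)
    finally show ?thesis .
  qed
  show "set_integrable lborel {0<..<t} (\<lambda>y. boost (iterated_integral f n y) (f y))"
    using product_integral_insert_rev(1)[OF _ _ G] by (simp add: inner set_integrable_def del: One_nat_def)
  have "iterated_integral f (Suc n) t = integral\<^sup>L (Pi\<^sub>M (insert (Suc n) {1..n}) (\<lambda>_. lborel)) G"
    unfolding ins G_def by (simp add: iterated_integral_def set_lebesgue_integral_def)
  also have "\<dots> = (LINT y:{0<..<t}|lborel. boost (iterated_integral f n y) (f y))"
    using product_integral_insert_rev(2)[OF _ _ G]
    by (simp add: inner set_lebesgue_integral_def del: One_nat_def)
  finally show "iterated_integral f (Suc n) t = (LINT y:{0<..<t}|lborel. boost (iterated_integral f n y) (f y))" .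
qed

lemma iterated_integral_increment:
  fixes f :: "real \<Rightarrow> real ^ 'd::finite"
  assumes f: "integrable lborel f" and "0 \<le> s" "s \<le> t"
  shows "iterated_integral f (Suc n) t = iterated_integral f (Suc n) s
      + integral {s..t} (\<lambda>y. boost (iterated_integral f n y) (f y))"
proof -
  let ?g = "\<lambda>y. boost (iterated_integral f n y) (f y)"
  have *: "?g integrable_on {0..r}" "iterated_integral f (Suc n) r = integral {0..r} ?g" for r
    using set_borel_integral_eq_integral[OF iterated_integral_Suc(1)[OF f, where t = r and n = n]]
      iterated_integral_Suc(2)[OF f, where t = r and n = n]
    by (simp_all add: integrable_on_open_interval_real integral_open_interval_real)
  show ?thesis
    unfolding *(2) using Henstock_Kurzweil_Integration.integral_combine[OF assms(2,3) *(1)[of t]] by simp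
qed

section \<open>Insertion maps and the signature\<close>

lemma normalised_signature_eq:
  "normalised_signature f n is
    = fact n * (LINT u:simplex_upto n 1|cube_measure n. elem_tensor (word f n u) is)"
  by (simp add: normalised_signature_def simplex_integral_def open_simplex_eq word_def)

lemma dev_functional_normalised_signature:
  fixes f :: "real \<Rightarrow> real ^ 'd::finite"
  assumes f: "integrable lborel f"
  shows "dev_functional n (normalised_signature f n) = fact n * snd (iterated_integral f n 1)"
proof -
  let ?M = "cube_measure n" and ?S = "simplex_upto n 1"
  let ?e = "\<lambda>is. develop (0, 1) (map (\<lambda>i. axis i 1) is) :: (real ^ 'd) \<times> real"
  have int: "integrable ?M (\<lambda>u. indicator ?S u * elem_tensor (word f n u) is)"
    if "length is = n" for "is"
    using integrable_elem_tensor_word[OF f that] by (simp add: set_integrable_def)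
  have "iterated_integral f n 1 = (LINT u|?M. indicator ?S u *\<^sub>R
      (\<Sum>is | length is = n. elem_tensor (word f n u) is *\<^sub>R ?e is))"
    unfolding iterated_integral_def set_lebesgue_integral_def
    by (subst develop_expansion) (simp del: One_nat_def)
  also have "\<dots> = (LINT u|?M. (\<Sum>is | length is = n.
      (indicator ?S u * elem_tensor (word f n u) is) *\<^sub>R ?e is))"
    by (simp add: scaleR_sum_right)
  also have "\<dots> = (\<Sum>is | length is = n. (LINT u|?M.
      (indicator ?S u * elem_tensor (word f n u) is) *\<^sub>R ?e is))"
    using int by (intro Bochner_Integration.integral_sum integrable_scaleR_left) auto
  also have "\<dots> = (\<Sum>is | length is = n.
      (LINT u|?M. indicator ?S u * elem_tensor (word f n u) is) *\<^sub>R ?e is)"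
    using int by (intro sum.cong refl integral_scaleR_left) auto
  finally show ?thesis
    by (simp add: dev_functional_def normalised_signature_eq set_lebesgue_integral_def snd_sum
        sum_distrib_left mult.assoc)
qed

text \<open>The inserted vector does not depend on the integration variables, so contracting its slot leaves
  the plain signature.\<close>

lemma contract_insertion_map:
  assumes "q \<le> n" "length is = n"
  shows "contract q z (insertion_map f (Suc q) n x) is = (z \<bullet> x) * normalised_signature f n is"
proof -
  have "insertion_map f (Suc q) n x (take q is @ i # drop q is)
      = x $ i * normalised_signature f n is" for i
  proof -
    have "[1..<n + 1] = [1..<Suc q] @ [Suc q..<n + 1]"
      using upt_add_eq_append[of 1 "Suc q" "n - q"] assms by (simp del: upt_Suc)
    then have "elem_tensor (map (\<lambda>i. f (u i)) [1..<Suc q] @ x # map (\<lambda>i. f (u i)) [Suc q..<n + 1])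
        (take q is @ i # drop q is) = x $ i * elem_tensor (word f n u) is" for u
      using assms elem_tensor_insert[of "take q is" "map (\<lambda>i. f (u i)) [1..<Suc q]" x _ i "drop q is"]
      by (simp add: word_def del: upt_Suc)
    then show ?thesis
      by (simp add: insertion_map_def simplex_integral_def normalised_signature_eq open_simplex_eq
          del: upt_Suc)
  qed
  then show ?thesis
    by (simp add: contract_def inner_vec_def sum_distrib_right mult.assoc)
qed

text \<open>Contracting the slot of the inserted vector with \<open>x - y\<close> maps the difference of the two insertions
  to \<open>\<parallel>x - y\<parallel>\<^sup>2\<close> times the signature, while it increases the projective norm by at most the factor
  \<open>\<parallel>x - y\<parallel>\<close>; one factor \<open>\<parallel>x - y\<parallel>\<close> survives.\<close>

lemma insertion_defect_separates:
  fixes f :: "real \<Rightarrow> real ^ 'd::finite"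
  assumes "admissible \<theta> n"
  shows "norm (x - y) * dev_functional n (normalised_signature f n)
    \<le> insertion_defect f \<theta> n x + insertion_defect f \<theta> n y"
proof -
  define q where "q = insertion_pos \<theta> n - 1"
  have q: "q \<le> n" "insertion_pos \<theta> n = Suc q"
    using assms by (auto simp: admissible_def q_def)
  define T where "T w = insertion_map f (Suc q) n w - normalised_signature f (n + 1)" for w
  have supp: "T w is = 0" if "length is \<noteq> Suc n" for w "is"
    using that q
    by (simp add: T_def insertion_map_def normalised_signature_def simplex_integral_def elem_tensor_def
        del: upt_Suc)
  let ?z = "x - y" and ?S = "normalised_signature f n"
  have le: "\<bar>dev_functional n (contract q ?z (T w))\<bar> \<le> norm ?z * insertion_defect f \<theta> n w" for w
  proof -
    have "\<bar>dev_functional n (contract q ?z (T w))\<bar> \<le> norm ?z * proj_norm (Suc n) (T w)"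
      by (rule dev_functional_contract_le[OF supp q(1)])
    then show ?thesis unfolding insertion_defect_def T_def q(2) by simp
  qed
  have nonneg: "0 \<le> insertion_defect f \<theta> n w" for w
  proof -
    (* Any nonzero vector serves here; it only has to be cancelled. *)
    have "0 \<le> norm (axis undefined 1 :: real ^ 'd) * proj_norm (Suc n) (T w)"
      by (rule order_trans[OF abs_ge_zero dev_functional_contract_le[OF supp q(1)]])
    then show ?thesis unfolding insertion_defect_def T_def q(2) by simp
  qed
  have ins: "dev_functional n (contract q ?z (insertion_map f (Suc q) n w)) = (?z \<bullet> w) * dev_functional n ?S" for w
    unfolding dev_functional_def sum_distrib_left
    by (intro sum.cong) (simp_all add: contract_insertion_map q(1) mult.assoc)
  have "norm ?z * (norm ?z * dev_functional n ?S) = (?z \<bullet> ?z) * dev_functional n ?S"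
    by (simp add: dot_square_norm power2_eq_square)
  also have "\<dots> = (?z \<bullet> x) * dev_functional n ?S - (?z \<bullet> y) * dev_functional n ?S"
    by (simp add: inner_diff_right left_diff_distrib)
  also have "\<dots> = dev_functional n (contract q ?z (T x)) - dev_functional n (contract q ?z (T y))"
    by (simp add: T_def contract_diff dev_functional_diff ins)
  also have "\<dots> \<le> norm ?z * insertion_defect f \<theta> n x + norm ?z * insertion_defect f \<theta> n y"
    using le[of x] le[of y] by linarith
  also have "\<dots> = norm ?z * (insertion_defect f \<theta> n x + insertion_defect f \<theta> n y)"
    by (simp add: distrib_left)
  finally show ?thesis
    using nonneg[of x] nonneg[of y] by (cases "x = y") auto
qed

section \<open>Linear segments\<close>

text \<open>For a unit vector \<open>v\<close>, these are the projections to the eigenspaces of the boost in direction \<open>v\<close>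
  for the eigenvalues \<open>1\<close>, \<open>-1\<close> and \<open>0\<close>.\<close>

definition proj_plus :: "real ^ 'd \<Rightarrow> (real ^ 'd) \<times> real \<Rightarrow> (real ^ 'd) \<times> real" where
  "proj_plus v z = ((snd z + fst z \<bullet> v) / 2) *\<^sub>R (v, 1)"

definition proj_minus :: "real ^ 'd \<Rightarrow> (real ^ 'd) \<times> real \<Rightarrow> (real ^ 'd) \<times> real" where
  "proj_minus v z = ((snd z - fst z \<bullet> v) / 2) *\<^sub>R (- v, 1)"

definition proj_zero :: "real ^ 'd \<Rightarrow> (real ^ 'd) \<times> real \<Rightarrow> (real ^ 'd) \<times> real" where
  "proj_zero v z = (fst z - (fst z \<bullet> v) *\<^sub>R v, 0)"

lemma proj_sum: "proj_plus v z + (proj_minus v z + proj_zero v z) = z"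
proof (rule prod_eqI)
  have "((snd z + fst z \<bullet> v) / 2) *\<^sub>R v - ((snd z - fst z \<bullet> v) / 2) *\<^sub>R v = (fst z \<bullet> v) *\<^sub>R v"
    unfolding scaleR_left_diff_distrib[symmetric] by (simp add: field_simps)
  then show "fst (proj_plus v z + (proj_minus v z + proj_zero v z)) = fst z"
    by (simp add: proj_plus_def proj_minus_def proj_zero_def algebra_simps)
qed (simp add: proj_plus_def proj_minus_def proj_zero_def field_simps)

lemma boost_proj:
  assumes "norm v = 1"
  shows "boost (proj_plus v z) v = proj_plus v z"
    and "boost (proj_minus v z) v = - proj_minus v z"
    and "boost (proj_zero v z) v = 0"
  using assms
  by (simp_all add: boost_def proj_plus_def proj_minus_def proj_zero_def inner_simps
      dot_square_norm zero_prod_def)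

lemma proj_zero_vector [simp]:
  "proj_plus v 0 = 0" "proj_minus v 0 = 0" "proj_zero v 0 = 0"
  by (simp_all add: proj_plus_def proj_minus_def proj_zero_def zero_prod_def)

text \<open>The \<open>n\<close>-th Taylor coefficient at 0 of the vector-valued exponential polynomial
  \<open>\<Sum> exp (\<mu> \<alpha>) z\<close> in the variable \<open>\<alpha>\<close>. The pairs \<open>(\<mu>, z)\<close> form a list and not a set, because
  equal pairs have to be counted with multiplicity.\<close>

definition exp_comb :: "(real \<times> 'a::real_vector) list \<Rightarrow> nat \<Rightarrow> 'a" where
  "exp_comb L n = (\<Sum>(\<mu>, z)\<leftarrow>L. (\<mu> ^ n / fact n) *\<^sub>R z)"

lemma exp_comb_Nil [simp]: "exp_comb [] n = 0"
  and exp_comb_Cons: "exp_comb ((\<mu>, z) # L) n = (\<mu> ^ n / fact n) *\<^sub>R z + exp_comb L n"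
  and exp_comb_append: "exp_comb (L @ L') n = exp_comb L n + exp_comb L' n"
  by (simp_all add: exp_comb_def)

text \<open>The effect of running with unit velocity \<open>v\<close> for time \<open>\<tau>\<close>: the exponential of \<open>\<alpha> \<tau>\<close> times the boost
  multiplies the three eigencomponents of a coefficient by \<open>exp (\<alpha> \<tau>)\<close>, \<open>exp (- \<alpha> \<tau>)\<close> and 1.\<close>

definition flow :: "real ^ 'd \<Rightarrow> real \<Rightarrow> (real \<times> (real ^ 'd) \<times> real) list
    \<Rightarrow> (real \<times> (real ^ 'd) \<times> real) list" where
  "flow v \<tau> L = concat (map (\<lambda>(\<mu>, z).
    [(\<mu> + \<tau>, proj_plus v z), (\<mu> - \<tau>, proj_minus v z), (\<mu>, proj_zero v z)]) L)"

lemma flow_Nil [simp]: "flow v \<tau> [] = []"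
  and flow_Cons: "flow v \<tau> ((\<mu>, z) # L) =
    (\<mu> + \<tau>, proj_plus v z) # (\<mu> - \<tau>, proj_minus v z) # (\<mu>, proj_zero v z) # flow v \<tau> L"
  by (simp_all add: flow_def)

lemma exp_comb_flow_0: "exp_comb (flow v 0 L) n = exp_comb L n"
proof (induction L)
  case (Cons p L)
  obtain \<mu> z where p: "p = (\<mu>, z)" by (cases p)
  have "exp_comb (flow v 0 (p # L)) n
      = (\<mu> ^ n / fact n) *\<^sub>R (proj_plus v z + (proj_minus v z + proj_zero v z)) + exp_comb L n"
    by (simp only: p flow_Cons exp_comb_Cons Cons scaleR_add_right add_0_right diff_0_right add.assoc)
  then show ?case by (simp only: proj_sum p exp_comb_Cons)
qed simp

text \<open>All three kinds of moving bases are instances, with \<open>b\<close> being \<open>1\<close>, \<open>-1\<close> or \<open>0\<close>.\<close>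

lemma has_vector_derivative_power_fact:
  "((\<lambda>x. ((a + b * x) ^ Suc n / fact (Suc n)) *\<^sub>R z)
    has_vector_derivative (b * ((a + b * x) ^ n / fact n)) *\<^sub>R z) (at x within S)"
proof -
  have "((\<lambda>x. (a + b * x) ^ Suc n / fact (Suc n)) has_field_derivative
      (real (Suc n) * (a + b * x) ^ n * b) / fact (Suc n)) (at x within S)"
    by (auto intro!: derivative_eq_intros simp del: power_Suc fact_Suc)
  also have "(real (Suc n) * (a + b * x) ^ n * b) / fact (Suc n) = b * ((a + b * x) ^ n / fact n)"
    by (simp add: field_simps del: of_nat_Suc)
  finally show ?thesis
    by (intro has_vector_derivative_scaleR[where g' = 0 and g = "\<lambda>_. z", simplified])
qed

lemma exp_comb_flow_derivative:
  fixes v :: "real ^ 'd::finite"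
  assumes "norm v = 1"
  shows "((\<lambda>\<tau>. exp_comb (flow v \<tau> L) (Suc n)) has_vector_derivative
    boost (exp_comb (flow v \<tau> L) n) v) (at \<tau> within S)"
proof (induction L)
  case Nil
  then show ?case
    by (simp add: bounded_bilinear.zero_left[OF bounded_bilinear_boost])
next
  case (Cons p L)
  obtain \<mu> z where p: "p = (\<mu>, z)" by (cases p)
  interpret B: bounded_bilinear "boost :: (real ^ 'd) \<times> real \<Rightarrow> real ^ 'd \<Rightarrow> _"
    by (rule bounded_bilinear_boost)
  have 1: "boost (exp_comb (flow v \<tau> (p # L)) n) v
      = (1 * ((\<mu> + 1 * \<tau>) ^ n / fact n)) *\<^sub>R proj_plus v z
      + ((- 1 * ((\<mu> + - 1 * \<tau>) ^ n / fact n)) *\<^sub>R proj_minus v z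
      + ((0 * ((\<mu> + 0 * \<tau>) ^ n / fact n)) *\<^sub>R proj_zero v z
      + boost (exp_comb (flow v \<tau> L) n) v))"
    by (simp add: p flow_Cons exp_comb_Cons B.add_left B.scaleR_left boost_proj[OF assms])
  have 2: "exp_comb (flow v \<tau> (p # L)) (Suc n)
      = ((\<mu> + 1 * \<tau>) ^ Suc n / fact (Suc n)) *\<^sub>R proj_plus v z
      + (((\<mu> + - 1 * \<tau>) ^ Suc n / fact (Suc n)) *\<^sub>R proj_minus v z
      + (((\<mu> + 0 * \<tau>) ^ Suc n / fact (Suc n)) *\<^sub>R proj_zero v z
      + exp_comb (flow v \<tau> L) (Suc n)))" for \<tau>
    by (simp add: p flow_Cons exp_comb_Cons)
  show ?case
    unfolding 1 2
    by (intro has_vector_derivative_add has_vector_derivative_power_fact Cons)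
qed

text \<open>The sequence \<open>D\<close> solves the hierarchy \<open>D\<^bsub>n+1\<^esub>' = boost D\<^sub>n v\<close> on the segment, and so does the flow;
  induction on \<open>n\<close> and the fundamental theorem of calculus show that both agree. The velocity may take
  arbitrary values at the endpoints of the segment, which do not affect the integral.\<close>

lemma flow_solves:
  fixes v :: "real ^ 'd::finite" and D :: "nat \<Rightarrow> real \<Rightarrow> (real ^ 'd) \<times> real"
  assumes v: "norm v = 1"
    and f: "\<And>y. y \<in> {s<..<s'} \<Longrightarrow> f y = v"
    and D0: "\<And>t. t \<in> {s..s'} \<Longrightarrow> D 0 t = D 0 s"
    and D_Suc: "\<And>n t. t \<in> {s..s'} \<Longrightarrow>
      D (Suc n) t = D (Suc n) s + integral {s..t} (\<lambda>y. boost (D n y) (f y))"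
    and init: "\<And>n. D n s = exp_comb L n"
    and "t \<in> {s..s'}"
  shows "D n t = exp_comb (flow v (t - s) L) n"
  using \<open>t \<in> {s..s'}\<close>
proof (induction n arbitrary: t)
  case 0
  have "exp_comb (flow v (t - s) L) 0 = exp_comb L 0"
  proof (induction L)
    case (Cons p L)
    then show ?case
      using proj_sum[of v "snd p"] by (cases p) (simp add: flow_Cons exp_comb_Cons add.assoc[symmetric])
  qed simp
  then show ?case using D0[OF 0] init[of 0] by simp
next
  case (Suc n)
  let ?R = "\<lambda>m y. exp_comb (flow v (y - s) L) m"
  have der: "(?R (Suc n) has_vector_derivative boost (?R n y) v) (at y within {s..t})" for y
  proof -
    have "((\<lambda>y. y - s) has_vector_derivative 1) (at y within {s..t})"
      by (auto intro!: derivative_eq_intros)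
    from vector_diff_chain_within[OF this exp_comb_flow_derivative[OF v]]
    show ?thesis by (simp add: o_def)
  qed
  have "((\<lambda>y. boost (?R n y) v) has_integral (?R (Suc n) t - ?R (Suc n) s)) {s..t}"
    using Suc.prems by (intro fundamental_theorem_of_calculus der) auto
  moreover have eq: "boost (D n y) (f y) = boost (?R n y) v" if "y \<in> {s..t} - {s, t}" for y
    using that Suc.prems Suc.IH[of y] f[of y] by auto
  ultimately have "((\<lambda>y. boost (D n y) (f y)) has_integral (?R (Suc n) t - ?R (Suc n) s)) {s..t}"
    by (intro has_integral_spike_finite[of "{s, t}" "{s..t}", OF _ eq]) auto
  then have "D (Suc n) t = D (Suc n) s + (?R (Suc n) t - ?R (Suc n) s)"
    using D_Suc[OF Suc.prems] by (simp add: integral_unique)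
  then show ?case using init[of "Suc n"] by (simp add: exp_comb_flow_0)
qed

lemma flow_remainder:
  assumes "\<And>\<mu> z. (\<mu>, z) \<in> set L \<Longrightarrow> \<bar>\<mu>\<bar> < s \<or> z = 0" and "0 < \<tau>"
    and "(\<mu>, z) \<in> set (flow v \<tau> L)"
  shows "\<bar>\<mu>\<bar> < s + \<tau> \<or> z = 0"
proof -
  obtain \<nu> w where "(\<nu>, w) \<in> set L"
    and "(\<mu>, z) \<in> {(\<nu> + \<tau>, proj_plus v w), (\<nu> - \<tau>, proj_minus v w), (\<nu>, proj_zero v w)}"
    using assms(3) unfolding flow_def by auto
  with assms(1)[of \<nu> w] \<open>0 < \<tau>\<close> show ?thesis by auto
qed

section \<open>Leading terms along the path\<close>

text \<open>The leading bases are \<open>t\<close> and \<open>-t\<close>, with coefficients in the \<open>1\<close>- and \<open>-1\<close>-eigenspaces of the boost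
  in direction \<open>v\<close>. The alternative \<open>z = 0\<close> accounts for the first segment: both coefficients
  start at the base 0, and the component of each that moves against its sign ends at modulus \<open>t\<close>,
  but it vanishes.\<close>

definition dominated_by :: "real \<Rightarrow> real ^ 'd \<Rightarrow> (nat \<Rightarrow> (real ^ 'd) \<times> real) \<Rightarrow> bool" where
  "dominated_by t v a \<longleftrightarrow> (\<exists>c L. 0 < c \<and>
    (\<forall>n. a n = exp_comb ((t, c *\<^sub>R (v, 1)) # (- t, c *\<^sub>R (- v, 1)) # L) n) \<and>
    (\<forall>(\<mu>, z)\<in>set L. \<bar>\<mu>\<bar> < t \<or> z = 0))"

text \<open>Both bases are 0 here, so only the sum of the two coefficients matters, and
  \<open>(0, 1) = (1/2) (v, 1) + (1/2) (-v, 1)\<close> for every \<open>v\<close>. Hence \<open>v\<close> may be chosen as the first velocity.\<close>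

lemma dominated_by_0:
  assumes "a 0 = (0, 1)" "\<And>n. a (Suc n) = 0"
  shows "dominated_by 0 v a"
  unfolding dominated_by_def
proof (intro exI conjI allI)
  show "a n = exp_comb ((0, (1 / 2) *\<^sub>R (v, 1)) # (- 0, (1 / 2) *\<^sub>R (- v, 1)) # []) n" for n
    using assms by (cases n) (simp_all add: exp_comb_Cons zero_prod_def)
qed auto

text \<open>The new leading terms come from the old ones through the eigenspaces that move outwards:
  projecting \<open>c (v', 1)\<close> to the line of \<open>(v, 1)\<close> multiplies \<open>c\<close> by \<open>(1 + v' \<bullet> v)/2\<close>, and likewise on
  the negative side. Every other new base has moved inwards or rested at some point, or comes from a
  base that was not leading, and so it falls behind \<open>s + \<tau>\<close>. At the start of the path, where \<open>s = 0\<close>,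
  inwards and outwards cannot be told apart; there the assumption \<open>v' = v\<close> makes the unwanted
  components vanish.\<close>

lemma dominated_by_flow:
  fixes v v' :: "real ^ 'd::finite"
  assumes a: "dominated_by s v' a"
    and flow: "\<And>L. (\<And>n. a n = exp_comb L n) \<Longrightarrow> (\<And>n. b n = exp_comb (flow v \<tau> L) n)"
    and v: "norm v = 1" and angle: "- 1 < v' \<bullet> v"
    and "0 < \<tau>" and s: "0 < s \<or> s = 0 \<and> v' = v"
  shows "dominated_by (s + \<tau>) v b"
proof -
  obtain c L where c: "0 < c" and
    a_eq: "\<And>n. a n = exp_comb ((s, c *\<^sub>R (v', 1)) # (- s, c *\<^sub>R (- v', 1)) # L) n" and
    L: "\<And>\<mu> z. (\<mu>, z) \<in> set L \<Longrightarrow> \<bar>\<mu>\<bar> < s \<or> z = 0"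
    using a unfolding dominated_by_def by blast
  let ?c = "c * (1 + v' \<bullet> v) / 2"
  let ?zp = "c *\<^sub>R (v', 1 :: real)" and ?zm = "c *\<^sub>R (- v', 1 :: real)"
  (* The six new terms from the two leading ones, except for the two that move outwards. *)
  define L' where "L' = [(s - \<tau>, proj_minus v ?zp), (s, proj_zero v ?zp),
    (- s + \<tau>, proj_plus v ?zm), (- s, proj_zero v ?zm)] @ flow v \<tau> L"
  have plus: "proj_plus v ?zp = ?c *\<^sub>R (v, 1)" and minus: "proj_minus v ?zm = ?c *\<^sub>R (- v, 1)"
    by (simp_all add: proj_plus_def proj_minus_def algebra_simps)
  have "b n = exp_comb ((s + \<tau>, ?c *\<^sub>R (v, 1)) # (- (s + \<tau>), ?c *\<^sub>R (- v, 1)) # L') n" for n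
  proof -
    have "- s - \<tau> = - (s + \<tau>)" by simp
    then show ?thesis
      unfolding flow[OF a_eq, of n] L'_def flow_Cons append_Cons append_Nil exp_comb_Cons plus minus
      by (simp only: add.assoc add.left_commute)
  qed
  moreover have "\<bar>\<mu>\<bar> < s + \<tau> \<or> z = 0" if "(\<mu>, z) \<in> set L'" for \<mu> z
  proof (cases "(\<mu>, z) \<in> set (flow v \<tau> L)")
    case True
    then show ?thesis using flow_remainder[OF L \<open>0 < \<tau>\<close>] by blast
  next
    case False
    have zero: "proj_minus v ?zp = 0 \<and> proj_plus v ?zm = 0" if "v' = v"
      using that v by (simp add: proj_minus_def proj_plus_def dot_square_norm zero_prod_def)
    from False that consider "\<mu> = s - \<tau>" "z = proj_minus v ?zp" | "\<mu> = s \<or> \<mu> = - s"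
      | "\<mu> = - s + \<tau>" "z = proj_plus v ?zm"
      unfolding L'_def by auto
    then show ?thesis
      using s zero \<open>0 < \<tau>\<close> by cases auto
  qed
  moreover have "0 < ?c" using c angle by simp
  ultimately show ?thesis
    unfolding dominated_by_def by blast
qed

text \<open>Along even \<open>n\<close> the powers of \<open>1\<close> and \<open>-1\<close> agree, and the last coordinates \<open>c\<close> of the two leading
  coefficients add up instead of cancelling.\<close>

lemma dominated_by_limit:
  assumes "dominated_by 1 v a"
  shows "\<exists>c>0. (\<lambda>k. fact (2 * k) * snd (a (2 * k))) \<longlonglongrightarrow> c"
proof -
  obtain c L where c: "0 < c" and
    a_eq: "\<And>n. a n = exp_comb ((1, c *\<^sub>R (v, 1)) # (- 1, c *\<^sub>R (- v, 1)) # L) n" and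
    L: "\<forall>(\<mu>, z)\<in>set L. \<bar>\<mu>\<bar> < 1 \<or> z = 0"
    using assms unfolding dominated_by_def by blast
  have rem: "(\<lambda>k. fact (2 * k) *\<^sub>R exp_comb L (2 * k)) \<longlonglongrightarrow> 0"
    using L
  proof (induction L)
    case (Cons p L)
    obtain \<mu> z where p: "p = (\<mu>, z)" by (cases p)
    have "(\<lambda>k. (\<mu> ^ (2 * k)) *\<^sub>R z) \<longlonglongrightarrow> 0"
    proof (cases "z = 0")
      case False
      then have "\<mu>\<^sup>2 < 1" using Cons.prems p by (auto simp: abs_square_less_1)
      then have "(\<lambda>k. (\<mu>\<^sup>2) ^ k) \<longlonglongrightarrow> 0" by (intro LIMSEQ_realpow_zero) auto
      then show ?thesis using tendsto_scaleR[OF _ tendsto_const[of z]] by (fastforce simp: power_mult)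
    qed simp
    from tendsto_add[OF this Cons.IH] Cons.prems show ?case
      by (simp add: p exp_comb_Cons scaleR_add_right)
  qed simp
  have "fact (2 * k) * snd (a (2 * k)) = 2 * c + snd (fact (2 * k) *\<^sub>R exp_comb L (2 * k))" for k
    by (simp add: a_eq exp_comb_Cons field_simps)
  moreover have "(\<lambda>k. 2 * c + snd (fact (2 * k) *\<^sub>R exp_comb L (2 * k))) \<longlonglongrightarrow> 2 * c + 0"
    using tendsto_snd[OF rem] by (intro tendsto_add tendsto_const) simp
  ultimately show ?thesis using c by (intro exI[of _ "2 * c"]) simp
qed

text \<open>Induction over the segments. The velocity before the first segment is \<open>v (0 - 1) = v 0\<close>, by
  truncated subtraction, so the start of the path counts as a corner at which nothing turns.\<close>

lemma iterated_integral_dominated: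
  fixes h :: "real \<Rightarrow> real ^ 'd::finite"
  assumes h: "integrable lborel h"
    and s0: "s 0 = 0" and s_less: "\<And>i. i < M \<Longrightarrow> s i < s (Suc i)"
    and hv: "\<And>i y. i < M \<Longrightarrow> y \<in> {s i<..<s (Suc i)} \<Longrightarrow> h y = v i"
    and unit: "\<And>i. i < M \<Longrightarrow> norm (v i) = 1"
    and angle: "\<And>i. 0 < i \<Longrightarrow> i < M \<Longrightarrow> - 1 < v (i - 1) \<bullet> v i"
    and "i \<le> M"
  shows "dominated_by (s i) (v (i - 1)) (\<lambda>n. iterated_integral h n (s i))"
  using \<open>i \<le> M\<close>
proof (induction i)
  case 0
  have "iterated_integral h (Suc n) 0 = 0" for n
    by (simp add: iterated_integral_Suc(2)[OF h] set_lebesgue_integral_def)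
  then show ?case
    by (simp add: s0 dominated_by_0 iterated_integral_0)
next
  case (Suc i)
  then have i: "i < M"
    and IH: "dominated_by (s i) (v (i - 1)) (\<lambda>n. iterated_integral h n (s i))" by simp_all
  have nonneg: "0 \<le> s j" if "j \<le> M" for j
    using that
  proof (induction j)
    case (Suc j)
    then show ?case using s_less[of j] by simp
  qed (simp add: s0)
  have "i = 0 \<or> 0 < s i"
    using nonneg[of "i - 1"] s_less[of "i - 1"] i by (cases i) auto
  then have start: "0 < s i \<or> s i = 0 \<and> v (i - 1) = v i"
    using s0 by auto
  have "- 1 < v (i - 1) \<bullet> v i"
    using angle[of i] i unit[of i] by (cases "i = 0") (auto simp: dot_square_norm)
  then have "dominated_by (s i + (s (Suc i) - s i)) (v i) (\<lambda>n. iterated_integral h n (s (Suc i)))"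
    using start s_less[OF i]
  proof (intro dominated_by_flow[OF IH])
    fix L n assume L: "\<And>n. iterated_integral h n (s i) = exp_comb L n"
    show "iterated_integral h n (s (Suc i)) = exp_comb (flow (v i) (s (Suc i) - s i) L) n"
    proof (rule flow_solves[where f = h and s' = "s (Suc i)" and D = "iterated_integral h"])
      show "iterated_integral h (Suc n) t = iterated_integral h (Suc n) (s i)
          + integral {s i..t} (\<lambda>y. boost (iterated_integral h n y) (h y))"
        if "t \<in> {s i..s (Suc i)}" for n t
        using that nonneg[of i] i by (intro iterated_integral_increment h) auto
    qed (use s_less[OF i] in \<open>simp_all add: unit[OF i] hv[OF i] L iterated_integral_0\<close>)
  qed (simp_all add: unit[OF i])
  then show ?case by simp
qed

section \<open>Piecewise linear paths\<close>

lemma eventually_admissible: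
  assumes "\<theta> \<in> {0<..<1}"
  shows "eventually (admissible \<theta>) sequentially"
proof -
  obtain N :: nat where N: "1 / \<theta> \<le> real N"
    using real_arch_simple by blast
  have "admissible \<theta> n" if n: "n \<ge> N + 1" for n
  proof -
    have "1 \<le> \<theta> * real N" using N assms by (simp add: field_simps)
    also have "\<dots> \<le> \<theta> * (real n + 2)" using n assms by (intro mult_left_mono) auto
    finally have "1 \<le> \<lfloor>\<theta> * (real n + 2)\<rfloor>" by (simp add: le_floor_iff)
    moreover have "\<theta> * (real n + 2) < 1 * (real n + 2)"
      using assms by (intro mult_strict_right_mono) auto
    then have "\<lfloor>\<theta> * (real n + 2)\<rfloor> < int n + 2" by (simp add: floor_less_iff)
    ultimately have "1 \<le> insertion_pos \<theta> n" "insertion_pos \<theta> n \<le> n + 1"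
      unfolding insertion_pos_def by linarith+
    then show ?thesis using n by (simp add: admissible_def)
  qed
  then show ?thesis unfolding eventually_sequentially by blast
qed

lemma arccos_pos_imp_less_1:
  assumes "0 < arccos x" "\<bar>x\<bar> \<le> 1"
  shows "x < 1"
  using assms by (cases "x = 1") auto

lemma cauchy_schwarz_quotient: "\<bar>(a \<bullet> b) / (norm a * norm b)\<bar> \<le> 1"
  using Cauchy_Schwarz_ineq2[of a b] by (cases "a = 0 \<or> b = 0") (auto simp: field_simps)

text \<open>The angle at a vertex is the one between \<open>- v (i - 1)\<close> and \<open>v i\<close>, so it is positive precisely
  when consecutive velocities are not opposite.\<close>

lemma nondegenerate_pl_path_velocities:
  fixes \<gamma> f :: "real \<Rightarrow> real ^ 'd::finite"
  assumes path: "nondegenerate_pl_path \<gamma>"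
    and f: "\<And>t. t \<in> {0<..<1} \<Longrightarrow> \<gamma> differentiable (at t) \<Longrightarrow>
           (\<gamma> has_vector_derivative f t) (at t) \<and> norm (f t) = 1"
  obtains M s v where "s 0 = 0" "s M = 1" "\<And>i. i < M \<Longrightarrow> s i < s (Suc i)"
    "\<And>i t. i < M \<Longrightarrow> t \<in> {s i<..<s (Suc i)} \<Longrightarrow> f t = v i"
    "\<And>i. i < M \<Longrightarrow> norm (v i) = 1"
    "\<And>i. 0 < i \<Longrightarrow> i < M \<Longrightarrow> - 1 < v (i - 1) \<bullet> v i"
proof -
  obtain M s and x :: "nat \<Rightarrow> real ^ 'd" where s0: "s 0 = 0" and sM: "s M = 1"
    and seg: "\<forall>i<M. s i < s (Suc i) \<and> x i \<noteq> x (Suc i) \<and>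
        (\<forall>t\<in>{s i..s (Suc i)}. \<gamma> t = linepath (x i) (x (Suc i)) ((t - s i) / (s (Suc i) - s i)))"
    and ang: "\<forall>i. 0 < i \<and> i < M \<longrightarrow> vec_angle (x (i - 1) - x i) (x (i + 1) - x i) \<in> {0<..<pi}"
    using path unfolding nondegenerate_pl_path_def by (elim exE conjE) (rule that)
  note seg = seg[rule_format]
  define v where "v i = (x (Suc i) - x i) /\<^sub>R (s (Suc i) - s i)" for i
  have s_le: "s i \<le> s j" if "i \<le> j" "j \<le> M" for i j
    using that
  proof (induction rule: dec_induct)
    case (step k)
    then show ?case using seg[of k] by simp
  qed simp
  have vel: "f t = v i \<and> norm (v i) = 1" if i: "i < M" and t: "t \<in> {s i<..<s (Suc i)}" for i t
  proof -
    have "((\<lambda>t. x i + (t - s i) *\<^sub>R v i) has_vector_derivative v i) (at t)"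
      by (auto intro!: derivative_eq_intros)
    moreover have "x i + (y - s i) *\<^sub>R v i = \<gamma> y" if "y \<in> {s i<..<s (Suc i)}" for y
      using seg[OF i] that by (simp add: linepath_def v_def algebra_simps divide_inverse)
    ultimately have der: "(\<gamma> has_vector_derivative v i) (at t)"
      by (rule has_vector_derivative_transform_within_open[OF _ open_greaterThanLessThan t])
    have "t \<in> {0<..<1}"
      using t s_le[of 0 i] s_le[of "Suc i" M] i s0 sM by auto
    then have "(\<gamma> has_vector_derivative f t) (at t) \<and> norm (f t) = 1"
      using f der differentiableI_vector by blast
    moreover from this have "f t = v i"
      using vector_derivative_unique_at der by blast
    ultimately show ?thesis by simp
  qed
  have unit: "norm (v i) = 1" if "i < M" for i
  proof -
    have "(s i + s (Suc i)) / 2 \<in> {s i<..<s (Suc i)}"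
      using seg[OF that] by auto
    then show ?thesis using vel[OF that] by blast
  qed
  show thesis
  proof (rule that[of s M v, OF s0 sM])
    show "s i < s (Suc i)" if "i < M" for i using seg[OF that] by simp
    show "f t = v i" if "i < M" "t \<in> {s i<..<s (Suc i)}" for i t using vel[OF that] by simp
    show "norm (v i) = 1" if "i < M" for i using unit[OF that] .
    show "- 1 < v (i - 1) \<bullet> v i" if i: "0 < i" "i < M" for i
    proof -
      define l where "l k = s (Suc k) - s k" for k
      have l: "0 < l (i - 1)" "0 < l i"
        using seg[of i] seg[of "i - 1"] i by (auto simp: l_def)
      have v: "x (Suc k) - x k = l k *\<^sub>R v k" if "0 < l k" for k
        using that by (simp add: v_def l_def)
      have eqs: "x (i - 1) - x i = - (l (i - 1) *\<^sub>R v (i - 1))" "x (i + 1) - x i = l i *\<^sub>R v i"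
        using v[OF l(1)] v[OF l(2)] i by (simp_all add: algebra_simps)
      have "(x (i - 1) - x i) \<bullet> (x (i + 1) - x i) / (norm (x (i - 1) - x i) * norm (x (i + 1) - x i))
          = - (v (i - 1) \<bullet> v i)"
        using l unit[of i] unit[of "i - 1"] i unfolding eqs by (simp add: field_simps)
      moreover have "(x (i - 1) - x i) \<bullet> (x (i + 1) - x i) / (norm (x (i - 1) - x i) * norm (x (i + 1) - x i)) < 1"
        using ang i by (intro arccos_pos_imp_less_1 cauchy_schwarz_quotient) (simp add: vec_angle_def)
      ultimately show ?thesis by simp
    qed
  qed
qed

text \<open>Nothing is known about \<open>f\<close> at the breakpoints, so they are added as singletons between the
  open segments.\<close>

lemma set_integrable_piecewise_constant:
  fixes f :: "real \<Rightarrow> real ^ 'd::finite"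
  assumes s_less: "\<And>i. i < M \<Longrightarrow> s i < s (Suc i)"
    and fv: "\<And>i t. i < M \<Longrightarrow> t \<in> {s i<..<s (Suc i)} \<Longrightarrow> f t = v i"
    and "i \<le> M"
  shows "set_integrable lborel {s 0<..s i} f"
  using \<open>i \<le> M\<close>
proof (induction i)
  case 0
  then show ?case by (simp add: set_integrable_def)
next
  case (Suc i)
  then have i: "i < M" by simp
  have s0: "s 0 \<le> s i"
    using \<open>Suc i \<le> M\<close>
  proof (induction i)
    case (Suc k)
    then show ?case using s_less[of k] by simp
  qed simp
  have "set_integrable lborel {s i<..<s (Suc i)} (\<lambda>_. v i)"
    using s_less[OF i] by (simp add: set_integrable_def)
  then have 1: "set_integrable lborel {s i<..<s (Suc i)} f"
    using fv[OF i] by (subst set_integrable_cong[OF refl refl]) auto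
  have "set_integrable lborel {s (Suc i)} (\<lambda>_. f (s (Suc i)))"
    by (simp add: set_integrable_def)
  then have 2: "set_integrable lborel {s (Suc i)} f"
    by (subst set_integrable_cong[OF refl refl]) auto
  have "{s 0<..s (Suc i)} = {s 0<..s i} \<union> ({s i<..<s (Suc i)} \<union> {s (Suc i)})"
    using s0 s_less[OF i] by auto
  then show ?case
    using Suc i 1 2 by (simp add: set_integrable_Un del: Un_insert_right)
qed

text \<open>Only the open interval matters; this allows a velocity that is unconstrained elsewhere to be cut
  off to an integrable function.\<close>

lemma normalised_signature_cong:
  assumes "\<And>t. t \<in> {0<..<1} \<Longrightarrow> f t = g t"
  shows "normalised_signature f n = normalised_signature g n"
proof (rule ext)
  fix "is"
  have "word f n u = word g n u" if "u \<in> simplex_upto n 1" for u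
    using that assms by (auto simp: word_def simplex_upto_def)
  then have "indicator (simplex_upto n 1) u *\<^sub>R elem_tensor (word f n u) is
      = indicator (simplex_upto n 1) u *\<^sub>R elem_tensor (word g n u) is" for u
    by (auto simp: indicator_def)
  then show "normalised_signature f n is = normalised_signature g n is"
    unfolding normalised_signature_eq set_lebesgue_integral_def by metis
qed

section \<open>Candidates for the inserted vector\<close>

lemma dev_functional_signature_limit:
  fixes \<gamma> f :: "real \<Rightarrow> real ^ 'd::finite"
  assumes path: "nondegenerate_pl_path \<gamma>"
    and f: "\<And>t. t \<in> {0<..<1} \<Longrightarrow> \<gamma> differentiable (at t) \<Longrightarrow>
           (\<gamma> has_vector_derivative f t) (at t) \<and> norm (f t) = 1"
  shows "\<exists>c>0. (\<lambda>k. dev_functional (2 * k) (normalised_signature f (2 * k))) \<longlonglongrightarrow> c"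
proof -
  obtain M s v where s0: "s 0 = 0" and sM: "s M = 1"
    and s_less: "\<And>i. i < M \<Longrightarrow> s i < s (Suc i)"
    and fv: "\<And>i t. i < M \<Longrightarrow> t \<in> {s i<..<s (Suc i)} \<Longrightarrow> f t = v i"
    and unit: "\<And>i. i < M \<Longrightarrow> norm (v i) = 1"
    and angle: "\<And>i. 0 < i \<Longrightarrow> i < M \<Longrightarrow> - 1 < v (i - 1) \<bullet> v i"
    by (rule nondegenerate_pl_path_velocities[OF path f]) (assumption | rule that)+
  have s_le: "s i \<le> s j" if "i \<le> j" "j \<le> M" for i j
    using that
  proof (induction rule: dec_induct)
    case (step k)
    then show ?case using s_less[of k] by simp
  qed simp
  define h where "h t = indicator {0<..<1} t *\<^sub>R f t" for t
  have "set_integrable lborel {0<..1} f"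
    using set_integrable_piecewise_constant[of M s f v M, OF s_less fv] s0 sM by simp
  then have "set_integrable lborel {0<..<1} f"
    by (rule set_integrable_subset) auto
  then have h: "integrable lborel h"
    by (simp add: set_integrable_def h_def[abs_def])
  have "dominated_by (s M) (v (M - 1)) (\<lambda>n. iterated_integral h n (s M))"
  proof (rule iterated_integral_dominated[where M = M and s = s and v = v, OF h s0 s_less _ unit angle])
    show "h t = v i" if "i < M" "t \<in> {s i<..<s (Suc i)}" for i t
    proof -
      have "t \<in> {0<..<1}"
        using that s_le[of 0 i] s_le[of "Suc i" M] s0 sM by auto
      then show ?thesis using fv[OF that] by (simp add: h_def)
    qed
  qed auto
  then have "dominated_by 1 (v (M - 1)) (\<lambda>n. iterated_integral h n 1)"
    unfolding sM .
  moreover have "normalised_signature f n = normalised_signature h n" for n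
    by (rule normalised_signature_cong) (simp add: h_def)
  then have "dev_functional n (normalised_signature f n) = fact n * snd (iterated_integral h n 1)" for n
    using dev_functional_normalised_signature[OF h] by metis
  ultimately show ?thesis
    using dominated_by_limit[of "v (M - 1)"] by (simp only:)
qed

theorem theorem5p1:
  fixes \<gamma> f :: "real \<Rightarrow> real ^ 'd::finite" and \<theta> :: real and \<epsilon> :: "nat \<Rightarrow> real"
  assumes "nondegenerate_pl_path \<gamma>"
    and "\<And>t. t \<in> {0<..<1} \<Longrightarrow> \<gamma> differentiable (at t) \<Longrightarrow>
           (\<gamma> has_vector_derivative f t) (at t) \<and> norm (f t) = 1"
    and "\<theta> \<in> {0<..<1}" and "\<gamma> differentiable (at \<theta>)"
    and "\<And>n. n \<ge> 1 \<Longrightarrow> 0 \<le> \<epsilon> n" and "\<epsilon> \<longlonglongrightarrow> 0"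
    and "\<And>n. admissible \<theta> n \<Longrightarrow> insertion_defect f \<theta> n (f \<theta>) \<le> \<epsilon> n"
  shows "\<exists>m :: nat \<Rightarrow> nat. strict_mono m \<and> (\<forall>k. admissible \<theta> (m k)) \<and>
           (\<forall>x y. (\<forall>k. x k \<in> insertion_candidates f \<theta> \<epsilon> (m k) \<and> y k \<in> insertion_candidates f \<theta> \<epsilon> (m k))
             \<longrightarrow> (\<lambda>k. norm (x k - y k)) \<longlonglongrightarrow> 0)"
proof -
  obtain c where "0 < c"
    and lim: "(\<lambda>k. dev_functional (2 * k) (normalised_signature f (2 * k))) \<longlonglongrightarrow> c"
    using dev_functional_signature_limit[OF assms(1,2)] by blast
  have "eventually (\<lambda>k. c / 2 < dev_functional (2 * k) (normalised_signature f (2 * k))) sequentially"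
    using order_tendstoD(1)[OF lim, of "c / 2"] \<open>0 < c\<close> by simp
  moreover have "eventually (\<lambda>k. admissible \<theta> (2 * k)) sequentially"
    by (rule eventually_subseq[OF _ eventually_admissible[OF assms(3)]]) (simp add: strict_mono_def)
  ultimately have "eventually (\<lambda>k. c / 2 < dev_functional (2 * k) (normalised_signature f (2 * k))
      \<and> admissible \<theta> (2 * k)) sequentially"
    by (rule eventually_conj)
  then obtain K where
    K: "\<And>k. k \<ge> K \<Longrightarrow> c / 2 < dev_functional (2 * k) (normalised_signature f (2 * k)) \<and> admissible \<theta> (2 * k)"
    unfolding eventually_sequentially by blast
  define m where "m k = 2 * (k + K)" for k
  have m: "strict_mono m" "\<And>k. admissible \<theta> (m k)"
    "\<And>k. c / 2 < dev_functional (m k) (normalised_signature f (m k))"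
    using K[of "_ + K"] by (simp_all add: m_def strict_mono_def)
  have "(\<lambda>k. norm (x k - y k)) \<longlonglongrightarrow> 0"
    if xy: "\<forall>k. x k \<in> insertion_candidates f \<theta> \<epsilon> (m k) \<and> y k \<in> insertion_candidates f \<theta> \<epsilon> (m k)" for x y
  proof (rule tendsto_sandwich[OF _ _ tendsto_const])
    have "norm (x k - y k) \<le> 4 / c * \<epsilon> (m k)" for k
    proof -
      have "norm (x k - y k) * (c / 2)
          \<le> norm (x k - y k) * dev_functional (m k) (normalised_signature f (m k))"
        using m(3)[of k] by (intro mult_left_mono) auto
      also have "\<dots> \<le> insertion_defect f \<theta> (m k) (x k) + insertion_defect f \<theta> (m k) (y k)"
        by (rule insertion_defect_separates[OF m(2)])
      also have "\<dots> \<le> 2 * \<epsilon> (m k)"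
        using xy[rule_format, of k] by (simp add: insertion_candidates_def)
      finally show ?thesis using \<open>0 < c\<close> by (simp add: field_simps)
    qed
    then show "eventually (\<lambda>k. norm (x k - y k) \<le> 4 / c * \<epsilon> (m k)) sequentially"
      by simp
    show "(\<lambda>k. 4 / c * \<epsilon> (m k)) \<longlonglongrightarrow> 0"
      using tendsto_mult_left[OF LIMSEQ_subseq_LIMSEQ[OF assms(6) m(1)], of "4 / c"] by (simp add: o_def)
  qed simp
  with m show ?thesis by blast
qed

end
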